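(* Let $K$ be a field of characteristic different from $2$ with algebraic closure $\bar K$, and let $q$ be the 2-division quartic of a pair $(C,P_2)$ over $K$. Then: (i) $\operatorname{disc}(q)\neq 0$ if and only if $C$ is smooth and $P_2$ is not 2-torsion. (ii) $q(x) = (x-s)^2(x-t)^2$ for distinct $s,t\in K$ if and only if $P_2$ is a 2-torsion point. (iii) $q(x) = (x-s)^2(x-t)(x-u)$ for distinct $s,t,u\in\bar K$ if and only if $C$ is nodal and $P_2$ is smooth and not 2-torsion. (iv) $q(x) = (x-s)^3(x-t)$ for distinct $s,t\in K$ if and only if $C$ is cuspidal and $P_2$ is a smooth point. (v) $q(x) = (x-s)^4$ if and only if $P_2$ is a singularity of $C$.
   Context: Let $K$ be a field with $\operatorname{char}(K)\neq 2$. A pair $(C,P_2)$ over $K$ consists of a plane cubic $C = \{y^2 = F(x)\}$, $F(x)= x^3 + ax^2 + bx + c$ with $a,b,c\in K$ (together with its point at infinity $O=(0:1:0)$), which may be singular, and a $K$-rational point $P_2=(x_2,y_2)\in C(K)\setminus\{O\}$, which may be a singular point of $C$. $C$ is singular if and only if $F$ has a multiple root; $C$ is nodal if $F(x)=(x-s)^2(x-t)$ with $s\ne t$ in $\bar K$, and cuspidal if $F(x)=(x-s)^3$ with $s\in\bar K$; the singular point is then $(s,0)$. The set of smooth points of $C$ is an abelian group under the usual chord-and-tangent law with identity $O$ and $-(x,y)=(x,-y)$; a 2-torsion point $P_2\neq O$ means a smooth point with $2P_2=O$ in this group. The 2-division quartic of $(C,P_2)$ is $$q(x) = x^4 - 4x_2x^3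 - (2b+4ax_2)x^2 - (8c+4bx_2)x + (b^2-4ac-4cx_2).$$
   Formalization: In (ii) and (iv) the roots s,t are taken in the algebraic closure, since with s,t in K both fail in general (e.g. (x^2-2)^2 over Q for (ii)); (iv) with s,t in K is also proved, unless K is an imperfect field of characteristic 3. *)

theory Defs
  imports
    "HOL-Algebra.Algebraic_Closure_Type"
    "Subresultants.Resultant_Prelim"
begin

definition cubic :: "'k::field \<Rightarrow> 'k \<Rightarrow> 'k \<Rightarrow> 'k poly" where
  "cubic a b c = [:c, b, a, 1:]"

text \<open>Points of the projective closure of \<open>y\<^sup>2 = F(x)\<close>; \<open>Infinity\<close> is \<open>(0:1:0)\<close>, the only
  point of the closure outside the affine chart.\<close>

datatype 'k cpoint = Infinity | Affine 'k 'k

fun on_curve :: "'k::field \<Rightarrow> 'k \<Rightarrow> 'k \<Rightarrow> 'k cpoint \<Rightarrow> bool" where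
  "on_curve a b c Infinity = True"
| "on_curve a b c (Affine x y) = (y\<^sup>2 = poly (cubic a b c) x)"

text \<open>Jacobian criterion: both partial derivatives of \<open>y\<^sup>2 - F(x)\<close> vanish. The point at infinity
  is never singular, since the partial derivative with respect to \<open>z\<close> of
  \<open>y\<^sup>2 z - (x\<^sup>3 + a x\<^sup>2 z + b x z\<^sup>2 + c z\<^sup>3)\<close> equals 1 at \<open>(0:1:0)\<close>.\<close>

fun singular_point :: "'k::field \<Rightarrow> 'k \<Rightarrow> 'k \<Rightarrow> 'k cpoint \<Rightarrow> bool" where
  "singular_point a b c Infinity = False"
| "singular_point a b c (Affine x y) =
     (on_curve a b c (Affine x y) \<and> 2 * y = 0 \<and> - poly (pderiv (cubic a b c)) x = 0)"

definition smooth_point :: "'k::field \<Rightarrow> 'k \<Rightarrow> 'k \<Rightarrow> 'k cpoint \<Rightarrow> bool" where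
  "smooth_point a b c P \<longleftrightarrow> on_curve a b c P \<and> \<not> singular_point a b c P"

text \<open>Smoothness of the curve is geometric: there is no singular point over the algebraic closure.\<close>

definition smooth_curve :: "'k::field \<Rightarrow> 'k \<Rightarrow> 'k \<Rightarrow> bool" where
  "smooth_curve a b c \<longleftrightarrow>
     (\<forall>P :: 'k alg_closure cpoint. \<not> singular_point (to_ac a) (to_ac b) (to_ac c) P)"

definition nodal :: "'k::field \<Rightarrow> 'k \<Rightarrow> 'k \<Rightarrow> bool" where
  "nodal a b c \<longleftrightarrow> (\<exists>s t :: 'k alg_closure. s \<noteq> t \<and>
     map_poly to_ac (cubic a b c) = [:-s, 1:]^2 * [:-t, 1:])"

definition cuspidal :: "'k::field \<Rightarrow> 'k \<Rightarrow> 'k \<Rightarrow> bool" where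
  "cuspidal a b c \<longleftrightarrow> (\<exists>s :: 'k alg_closure.
     map_poly to_ac (cubic a b c) = [:-s, 1:]^3)"

text \<open>The chord-and-tangent law, meaningful for smooth points of the curve. The line through the
  two points (the tangent if they coincide) is vertical exactly in the case with result
  \<open>Infinity\<close>; otherwise it has slope \<open>m\<close>, and substituting it into the equation gives a
  monic cubic in \<open>x\<close> whose roots sum to \<open>m\<^sup>2 - a\<close>. The third intersection point is then
  reflected in the \<open>x\<close>-axis. The coefficient \<open>c\<close> does not enter.\<close>

fun point_add :: "'k::field \<Rightarrow> 'k \<Rightarrow> 'k cpoint \<Rightarrow> 'k cpoint \<Rightarrow> 'k cpoint" where
  "point_add a b Infinity Q = Q"
| "point_add a b P Infinity = P"
| "point_add a b (Affine x1 y1) (Affine x2 y2) =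
     (if x1 = x2 \<and> y1 = - y2 then Infinity
      else let m = (if x1 = x2 then (3 * x1\<^sup>2 + 2 * a * x1 + b) / (2 * y1)
                    else (y2 - y1) / (x2 - x1));
               x3 = m\<^sup>2 - a - x1 - x2
           in Affine x3 (m * (x1 - x3) - y1))"

definition two_torsion :: "'k::field \<Rightarrow> 'k \<Rightarrow> 'k \<Rightarrow> 'k cpoint \<Rightarrow> bool" where
  "two_torsion a b c P \<longleftrightarrow>
     P \<noteq> Infinity \<and> smooth_point a b c P \<and> point_add a b P P = Infinity"

definition division_quartic :: "'k::field \<Rightarrow> 'k \<Rightarrow> 'k \<Rightarrow> 'k \<Rightarrow> 'k poly" where
  "division_quartic a b c x2 =
     [:b\<^sup>2 - 4 * a * c - 4 * c * x2, - (8 * c + 4 * b * x2), - (2 * b + 4 * a * x2), - 4 * x2, 1:]"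

text \<open>The discriminant via the Sylvester matrix of formal size \<open>(n, n - 1)\<close>, so that it is the usual
  universal polynomial in the coefficients of a monic polynomial even if the characteristic
  divides the degree \<open>n\<close>.\<close>

definition poly_disc :: "'k::field poly \<Rightarrow> 'k" where
  "poly_disc p = (let n = Polynomial.degree p in
     (- 1) ^ (n * (n - 1) div 2) * resultant_sub n (n - 1) p (pderiv p) / lead_coeff p)"

end

theory Submission
  imports Defs
begin

text \<open>
  On a smooth curve the roots of \<open>q\<close> are the \<open>x\<close>-coordinates of the points \<open>Q\<close> with
  \<open>2 Q = \<plusminus> P\<^sub>2\<close>, and coincidences among them, as well as degenerations of the curve, show up as
  multiple roots. The pairs \<open>(C, P\<^sub>2)\<close> fall into five classes: \<open>C\<close> smooth and \<open>P\<^sub>2\<close> not 2-torsion;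
  \<open>P\<^sub>2\<close> 2-torsion; \<open>C\<close> nodal and \<open>P\<^sub>2\<close> smooth but not 2-torsion; \<open>C\<close> cuspidal and \<open>P\<^sub>2\<close> smooth; \<open>P\<^sub>2\<close> singular. These classes exhaust
  all pairs, because a singular point of \<open>C\<close> lies over a multiple root of \<open>F\<close>. The five root patterns of
  \<open>q\<close> exclude each other, because a polynomial determines the multiset of its root multiplicities.
  It is therefore enough to show that each class forces its pattern; the five converses follow.

  For the four classes with a multiple root, explicit factorisations do this. If \<open>y\<^sub>2 = 0\<close>, then \<open>q\<close>
  is the square of \<open>(x - x\<^sub>2)\<^sup>2 - F'(x\<^sub>2)\<close> (\<open>division_quartic_of_root\<close>); this covers both
  2-torsion points and singular points. If \<open>F = (x - s)\<^sup>2 (x - t)\<close>, then \<open>q\<close> is \<open>(x - s)\<^sup>2\<close> times a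
  quadratic with discriminant \<open>16 (x\<^sub>2 - s) (x\<^sub>2 - t)\<close> (\<open>division_quartic_of_double_root\<close>); this
  covers nodes and cusps.

  For the remaining class one has to see that \<open>q\<close> has no multiple root. Put \<open>N = q + 4 x\<^sub>2 F\<close>, which
  does not involve \<open>x\<^sub>2\<close>. The map \<open>x \<mapsto> N / (4 F)\<close> is duplication on \<open>x\<close>-coordinates, and the
  duplication formula for \<open>y\<close> says that \<open>64 F\<^sup>3\<close> times the value of the cubic at \<open>N / (4 F)\<close> is the
  square of \<open>N' F - N F'\<close>. At a multiple root of \<open>q\<close> one has \<open>N = 4 x\<^sub>2 F\<close> and \<open>N' = 4 x\<^sub>2 F'\<close>, so the
  square vanishes and \<open>64 F\<^sup>3 y\<^sub>2\<^sup>2 = 0\<close>: either \<open>y\<^sub>2 = 0\<close>, or the root is the \<open>x\<close>-coordinate of a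
  singular point (\<open>division_quartic_multiple_root\<close>).

  The discriminant enters only through the fact that it vanishes exactly when there is a multiple
  root in the algebraic closure (\<open>poly_disc_eq_0_iff_multiple_root\<close>), which comes from a description
  of the kernel of the Sylvester matrix. Finally, \<open>q\<close> has its triple root in \<open>K\<close> itself as soon as
  the cusp is \<open>K\<close>-rational: \<open>s = - a / 3\<close> in characteristic other than 3, and \<open>s\<^sup>3 = - c\<close> in
  characteristic 3 (\<open>cusp_in_range_to_ac\<close>).
\<close>

section \<open>Sylvester matrices and common roots\<close>

interpretation to_ac: inj_comm_ring_hom to_ac
  by unfold_locales auto

interpretation to_ac_poly: map_poly_inj_comm_ring_hom to_ac ..

text \<open>
  Euclid's lemma with coprimality expressed through roots: a linear factor of \<open>w q\<close> whose root is
  not a root of \<open>q\<close> is a factor of \<open>w\<close> and can be cancelled.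
\<close>

lemma prod_linear_dvd_mult_cancel:
  fixes w q :: "'a::field poly"
  assumes "(\<Prod>x\<in>#A. [:-x, 1:]) dvd w * q" and "\<And>x. x \<in># A \<Longrightarrow> poly q x \<noteq> 0"
  shows "(\<Prod>x\<in>#A. [:-x, 1:]) dvd w"
  using assms
proof (induction A arbitrary: w)
  case (add x A)
  let ?P = "\<Prod>x\<in>#A. [:-x, 1:]"
  have div: "[:-x, 1:] * ?P dvd w * q"
    using add.prems(1) by simp
  then have "poly (w * q) x = 0"
    by (meson dvd_mult_left poly_eq_0_iff_dvd)
  then have "poly w x = 0"
    using add.prems(2)[of x] by simp
  then obtain w' where w': "w = [:-x, 1:] * w'"
    by (meson dvd_def poly_eq_0_iff_dvd)
  have "[:-x, 1:] * ?P dvd [:-x, 1:] * (w' * q)"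
    using div unfolding w' by (simp only: mult.assoc)
  then have "?P dvd w' * q"
    using dvd_mult_cancel_left[of "[:-x, 1:]"] by (metis one_neq_zero pCons_eq_0_iff)
  then have "?P dvd w'"
    using add.prems(2) by (rule add.IH) auto
  then have "[:-x, 1:] * ?P dvd w"
    unfolding w' by (intro mult_dvd_mono dvd_refl)
  then show ?case
    by simp
qed auto

text \<open>
  The rows of the Sylvester matrix are the coefficient vectors, highest power first, of
  \<open>X\<^sup>n\<^sup>-\<^sup>1 p, \<dots>, p\<close> and \<open>X\<^sup>m\<^sup>-\<^sup>1 q, \<dots>, q\<close>. In this form a vector in its left kernel is a
  syzygy \<open>u p + w q = 0\<close>, and evaluation at \<open>x\<close> is multiplication by a vector of powers of \<open>x\<close>.
\<close>

definition sylvester_row :: "nat \<Rightarrow> nat \<Rightarrow> 'a::comm_ring_1 poly \<Rightarrow> 'a poly \<Rightarrow> nat \<Rightarrow> 'a poly" where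
  "sylvester_row m n p q i =
     (if i < n then monom 1 (n - 1 - i) * p else monom 1 (m + n - 1 - i) * q)"

lemma sylvester_mat_sub_eq_coeff_row:
  fixes p q :: "'a::comm_ring_1 poly"
  assumes "degree p \<le> m" "degree q \<le> n" "i < m + n" "j < m + n"
  shows "sylvester_mat_sub m n p q $$ (i, j) = coeff (sylvester_row m n p q i) (m + n - 1 - j)"
proof (cases "i < n")
  case True
  have *: "m + n - 1 - j - (n - 1 - i) = m + i - j"
    using True assms by linarith
  show ?thesis
  proof (cases "i \<le> j \<and> j - i \<le> m")
    case i: True
    then show ?thesis using True assms *
      by (auto simp: sylvester_mat_sub_index sylvester_row_def coeff_monom_mult)
  next
    case False
    then consider "j < i" | "j > m + i" by linarith
    then show ?thesis
    proof cases
      case 1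
      then have "m + i - j > degree p" using assms by linarith
      then have "coeff p (m + i - j) = 0" by (rule coeff_eq_0)
      with False True show ?thesis using assms *
        by (auto simp: sylvester_mat_sub_index sylvester_row_def coeff_monom_mult)
    next
      case 2
      then have "m + n - 1 - j < n - 1 - i" using assms True by linarith
      with False True show ?thesis using assms
        by (auto simp: sylvester_mat_sub_index sylvester_row_def coeff_monom_mult)
    qed
  qed
next
  case False
  have *: "m + n - 1 - j - (m + n - 1 - i) = i - j"
    using assms by linarith
  show ?thesis
  proof (cases "i - n \<le> j")
    case i: True
    have "(m + n - 1 - i \<le> m + n - 1 - j) = (j \<le> i)" using assms by linarith
    with i False show ?thesis using assms *
      by (auto simp: sylvester_mat_sub_index sylvester_row_def coeff_monom_mult)
  next
    case i: False
    then have "coeff q (i - j) = 0" using assms by (intro coeff_eq_0) linarith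
    with i False show ?thesis using assms *
      by (auto simp: sylvester_mat_sub_index sylvester_row_def coeff_monom_mult)
  qed
qed

lemma degree_sylvester_row_less:
  fixes p q :: "'a::comm_ring_1 poly"
  assumes "degree p \<le> m" "degree q \<le> n" "i < m + n"
  shows "degree (sylvester_row m n p q i) < m + n"
proof (cases "i < n")
  case True
  have "degree (monom 1 (n - 1 - i) * p) \<le> (n - 1 - i) + degree p"
    by (rule order.trans[OF degree_mult_le]) (simp add: degree_monom_le)
  with True assms show ?thesis by (auto simp: sylvester_row_def)
next
  case False
  have "degree (monom 1 (m + n - 1 - i) * q) \<le> (m + n - 1 - i) + degree q"
    by (rule order.trans[OF degree_mult_le]) (simp add: degree_monom_le)
  with False assms show ?thesis by (auto simp: sylvester_row_def)
qed

lemma sum_sylvester_rows: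
  fixes p q :: "'a::comm_ring_1 poly"
  shows "(\<Sum>i<m+n. smult (f i) (sylvester_row m n p q i)) =
     (\<Sum>i<n. monom (f i) (n - 1 - i)) * p + (\<Sum>i<m. monom (f (n + i)) (m - 1 - i)) * q"
proof -
  have "(\<Sum>i<m+n. smult (f i) (sylvester_row m n p q i)) =
    (\<Sum>i<n. smult (f i) (sylvester_row m n p q i)) +
    (\<Sum>i<m. smult (f (n+i)) (sylvester_row m n p q (n+i)))"
    by (simp add: add.commute[of m n] sum.atLeastLessThan_concat[of 0 n "n+m", symmetric]
        lessThan_atLeast0 sum.atLeastLessThan_shift_0[of _ n "n+m"])
  also have "(\<Sum>i<n. smult (f i) (sylvester_row m n p q i)) = (\<Sum>i<n. monom (f i) (n - 1 - i)) * p"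
    unfolding sum_distrib_right
    by (rule sum.cong) (simp_all add: sylvester_row_def smult_monom flip: mult_smult_left)
  also have "(\<Sum>i<m. smult (f (n+i)) (sylvester_row m n p q (n+i))) =
     (\<Sum>i<m. monom (f (n + i)) (m - 1 - i)) * q"
    unfolding sum_distrib_right
    by (rule sum.cong) (simp_all add: sylvester_row_def smult_monom add.commute flip: mult_smult_left)
  finally show ?thesis .
qed

lemma coeff_sum_monom_rev:
  assumes "i < n"
  shows "coeff (\<Sum>i<n. monom (f i) (n - 1 - i)) (n - 1 - i) = f i"
proof -
  have "coeff (\<Sum>i<n. monom (f i) (n - 1 - i)) (n - 1 - i) = (\<Sum>k<n. if k = i then f i else 0)"
    unfolding coeff_sum coeff_monom using assms by (intro sum.cong) auto
  also have "\<dots> = f i" using assms by simp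
  finally show ?thesis .
qed

text \<open>
  A common root \<open>x\<close> gives the right kernel vector of the powers of \<open>x\<close>. Conversely, a left kernel
  vector gives \<open>u p + w q = 0\<close> with \<open>deg w < m\<close>; without common roots \<open>p\<close> would divide \<open>w\<close>, so
  \<open>w = 0\<close> and \<open>u = 0\<close>. The formal degree \<open>n\<close> of \<open>q\<close> may exceed its degree, as happens for
  derivatives in positive characteristic; only \<open>p\<close> must have full degree.
\<close>

lemma resultant_sub_eq_0_iff_common_root:
  fixes p q :: "'a::alg_closed_field poly"
  assumes "degree p = m" "m > 0" "degree q \<le> n"
  shows "resultant_sub m n p q = 0 \<longleftrightarrow> (\<exists>x. poly p x = 0 \<and> poly q x = 0)"
proof
  let ?S = "sylvester_mat_sub m n p q" and ?R = "sylvester_row m n p q"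
  have S: "?S \<in> carrier_mat (m + n) (m + n)"
    by (rule sylvester_mat_sub_carrier)
  have entry: "?S $$ (i, j) = coeff (?R i) (m + n - 1 - j)" if "i < m + n" "j < m + n" for i j
    using assms that by (intro sylvester_mat_sub_eq_coeff_row) auto
  have degR: "degree (?R i) < m + n" if "i < m + n" for i
    using assms that by (intro degree_sylvester_row_less) auto
  {
    assume "\<exists>x. poly p x = 0 \<and> poly q x = 0"
    then obtain x where x: "poly p x = 0" "poly q x = 0" by blast
    define v where "v = vec (m + n) (\<lambda>j. x ^ (m + n - 1 - j))"
    have v: "v \<in> carrier_vec (m + n)" by (simp add: v_def)
    have "v $ (m + n - 1) \<noteq> 0\<^sub>v (m + n) $ (m + n - 1)"
      using assms by (simp add: v_def)
    then have "v \<noteq> 0\<^sub>v (m + n)" by metis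
    moreover have "?S *\<^sub>v v = 0\<^sub>v (m + n)"
    proof (rule eq_vecI)
      fix i assume "i < dim_vec (0\<^sub>v (m + n) :: 'a vec)"
      then have i: "i < m + n" by simp
      have "(?S *\<^sub>v v) $ i = (\<Sum>j<m+n. coeff (?R i) (m + n - 1 - j) * x ^ (m + n - 1 - j))"
        using i S entry by (auto simp: scalar_prod_def v_def lessThan_atLeast0 intro!: sum.cong)
      also have "\<dots> = (\<Sum>k<m+n. coeff (?R i) k * x ^ k)"
        using sum.nat_diff_reindex[of "\<lambda>k. coeff (?R i) k * x ^ k" "m + n"] by simp
      also have "\<dots> = poly (?R i) x"
        unfolding poly_altdef using degR[OF i]
        by (intro sum.mono_neutral_right) (auto simp: coeff_eq_0)
      also have "\<dots> = 0" using x by (simp add: sylvester_row_def)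
      finally show "(?S *\<^sub>v v) $ i = 0\<^sub>v (m + n) $ i" using i by simp
    qed simp
    ultimately show "resultant_sub m n p q = 0"
      unfolding resultant_sub_def using det_0_iff_vec_prod_zero[OF S] v by blast
  }
  {
    assume "resultant_sub m n p q = 0"
    then have "det (transpose_mat ?S) = 0"
      unfolding resultant_sub_def using det_transpose[OF S] by simp
    then obtain v where v: "v \<in> carrier_vec (m + n)" "v \<noteq> 0\<^sub>v (m + n)"
      and ker: "transpose_mat ?S *\<^sub>v v = 0\<^sub>v (m + n)"
      using det_0_iff_vec_prod_zero[of "transpose_mat ?S" "m + n"] S by auto
    define u where "u = (\<Sum>i<n. monom (v $ i) (n - 1 - i))"
    define w where "w = (\<Sum>i<m. monom (v $ (n + i)) (m - 1 - i))"
    have "(\<Sum>i<m+n. smult (v $ i) (?R i)) = 0"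
    proof (rule poly_eqI)
      fix k
      show "coeff (\<Sum>i<m+n. smult (v $ i) (?R i)) k = coeff 0 k"
      proof (cases "k < m + n")
        case True
        define j where "j = m + n - 1 - k"
        have j: "j < m + n" "m + n - 1 - j = k" using True by (auto simp: j_def)
        have "(transpose_mat ?S *\<^sub>v v) $ j = (\<Sum>i<m+n. ?S $$ (i, j) * v $ i)"
          using j S v by (auto simp: scalar_prod_def lessThan_atLeast0 intro!: sum.cong)
        also have "\<dots> = (\<Sum>i<m+n. v $ i * coeff (?R i) k)"
          using j by (intro sum.cong) (auto simp: entry)
        finally show ?thesis using ker j by (simp add: coeff_sum)
      next
        case False
        have "coeff (?R i) k = 0" if "i < m + n" for i
          using degR[OF that] False by (intro coeff_eq_0) linarith
        then show ?thesis by (simp add: coeff_sum)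
      qed
    qed
    then have bez: "u * p + w * q = 0"
      unfolding u_def w_def by (simp only: sum_sylvester_rows)
    show "\<exists>x. poly p x = 0 \<and> poly q x = 0"
    proof (rule ccontr)
      assume no_root: "\<not> ?thesis"
      have "p \<noteq> 0" using assms by auto
      then obtain A where A: "p = smult (lead_coeff p) (\<Prod>x\<in>#A. [:-x, 1:])"
        using alg_closed_imp_factorization by blast
      have "p dvd w * q"
        using bez by (metis add.commute add_eq_0_iff dvd_minus_iff dvd_triv_right)
      moreover have "poly p x = 0" if "x \<in># A" for x
      proof -
        have "poly (\<Prod>x\<in>#A. [:-x, 1:]) x = 0"
          using that by (auto simp: poly_eq_0_iff_dvd intro: dvd_prod_mset)
        then show ?thesis by (subst A) simp
      qed
      ultimately have "p dvd w"
        using prod_linear_dvd_mult_cancel[of A w q] no_root \<open>p \<noteq> 0\<close>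
        by (metis A leading_coeff_0_iff smult_dvd_iff)
      moreover have "degree w < m"
        unfolding w_def using \<open>m > 0\<close>
        by (intro degree_sum_less) (auto intro: le_less_trans[OF degree_monom_le])
      ultimately have "w = 0"
        using assms(1) dvd_imp_degree_le by (metis not_less)
      with bez \<open>p \<noteq> 0\<close> have "u = 0" by simp
      have "v $ i = 0" if "i < m + n" for i
      proof (cases "i < n")
        case True
        then show ?thesis using coeff_sum_monom_rev[of i n "\<lambda>i. v $ i"] \<open>u = 0\<close>
          by (simp add: u_def)
      next
        case False
        then show ?thesis
          using that coeff_sum_monom_rev[of "i - n" m "\<lambda>i. v $ (n + i)"] \<open>w = 0\<close>
          by (simp add: w_def)
      qed
      then have "v = 0\<^sub>v (m + n)" using v(1) by (intro eq_vecI) auto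
      with v(2) show False by contradiction
    qed
  }
qed

lemma multiple_root_of_square_factor:
  fixes p g :: "'a::field poly"
  assumes "p = [:-s, 1:]^2 * g"
  shows "poly p s = 0" and "poly (pderiv p) s = 0"
  unfolding assms by (simp_all add: pderiv_mult pderiv_power)

lemma poly_disc_eq_0_iff_multiple_root:
  fixes p :: "'k::field poly"
  assumes "degree p > 0"
  shows "poly_disc p = 0 \<longleftrightarrow>
    (\<exists>x :: 'k alg_closure. poly (map_poly to_ac p) x = 0 \<and> poly (pderiv (map_poly to_ac p)) x = 0)"
proof -
  let ?n = "degree p" and ?p = "map_poly to_ac p"
  have der: "map_poly to_ac (pderiv p) = pderiv ?p"
    by (rule poly_eqI) (simp add: coeff_pderiv coeff_map_poly)
  have "poly_disc p = 0 \<longleftrightarrow> resultant_sub ?n (?n - 1) p (pderiv p) = 0"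
    using assms by (auto simp: poly_disc_def Let_def)
  also have "\<dots> \<longleftrightarrow> to_ac (resultant_sub ?n (?n - 1) p (pderiv p)) = 0"
    by simp
  also have "to_ac (resultant_sub ?n (?n - 1) p (pderiv p)) = resultant_sub ?n (?n - 1) ?p (pderiv ?p)"
    unfolding resultant_sub_def to_ac.hom_det[symmetric] sylvester_mat_sub_map[of to_ac, OF to_ac_0] der ..
  also have "\<dots> = 0 \<longleftrightarrow> (\<exists>x. poly ?p x = 0 \<and> poly (pderiv ?p) x = 0)"
    using assms degree_pderiv_le[of ?p] by (intro resultant_sub_eq_0_iff_common_root) auto
  finally show ?thesis .
qed

section \<open>Multiple roots of the 2-division quartic\<close>

lemma map_poly_to_ac_cubic: "map_poly to_ac (cubic a b c) = cubic (to_ac a) (to_ac b) (to_ac c)"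
  by (simp add: cubic_def map_poly_pCons)

lemma map_poly_to_ac_division_quartic:
  "map_poly to_ac (division_quartic a b c x2) =
     division_quartic (to_ac a) (to_ac b) (to_ac c) (to_ac x2)"
  by (simp add: division_quartic_def map_poly_pCons)

lemma poly_cubic: "poly (cubic a b c) x = x ^ 3 + a * x\<^sup>2 + b * x + c"
  by (simp add: cubic_def power2_eq_square power3_eq_cube algebra_simps)

lemma poly_pderiv_cubic: "poly (pderiv (cubic a b c)) x = 3 * x\<^sup>2 + 2 * a * x + b"
  by (simp add: cubic_def pderiv_pCons power2_eq_square algebra_simps)

lemma poly_division_quartic:
  "poly (division_quartic a b c x2) x =
     x ^ 4 - 4 * x2 * x ^ 3 - (2 * b + 4 * a * x2) * x\<^sup>2 - (8 * c + 4 * b * x2) * x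
       + (b\<^sup>2 - 4 * a * c - 4 * c * x2)"
  by (simp add: division_quartic_def eval_nat_numeral algebra_simps)

lemma poly_pderiv_division_quartic:
  "poly (pderiv (division_quartic a b c x2)) x =
     4 * x ^ 3 - 12 * x2 * x\<^sup>2 - 2 * (2 * b + 4 * a * x2) * x - (8 * c + 4 * b * x2)"
  by (simp add: division_quartic_def pderiv_pCons eval_nat_numeral algebra_simps)

text \<open>
  If \<open>F(r) \<noteq> 0\<close>, this is the duplication argument: the \<open>y\<close>-coordinate of the doubled point is
  proportional to \<open>N' F - N F'\<close>, which vanishes at a multiple root of \<open>q\<close>. If \<open>F(r) = 0\<close>, the double
  of \<open>(r, 0)\<close> is no affine point, and \<open>N = F'\<^sup>2 - 4 (2 x + a) F\<close> gives \<open>F'(r) = 0\<close> instead.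
\<close>

lemma division_quartic_multiple_root:
  fixes a b c x2 y2 r :: "'a::field"
  assumes two: "(2::'a) \<noteq> 0" and curve: "y2\<^sup>2 = poly (cubic a b c) x2"
    and root: "poly (division_quartic a b c x2) r = 0"
    and der: "poly (pderiv (division_quartic a b c x2)) r = 0"
  shows "y2 = 0 \<or> poly (cubic a b c) r = 0 \<and> poly (pderiv (cubic a b c)) r = 0"
proof -
  define F where "F = r ^ 3 + a * r\<^sup>2 + b * r + c"
  define F' where "F' = 3 * r\<^sup>2 + 2 * a * r + b"
  define N where "N = r ^ 4 - 2 * b * r\<^sup>2 - 8 * c * r + b\<^sup>2 - 4 * a * c"
  define N' where "N' = 4 * r ^ 3 - 4 * b * r - 8 * c"
  have q: "N = 4 * x2 * F"
  proof -
    have "N - 4 * x2 * F = poly (division_quartic a b c x2) r"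
      unfolding poly_division_quartic N_def F_def by (simp add: eval_nat_numeral algebra_simps)
    then show ?thesis using root by simp
  qed
  have q': "N' = 4 * x2 * F'"
  proof -
    have "N' - 4 * x2 * F' = poly (pderiv (division_quartic a b c x2)) r"
      unfolding poly_pderiv_division_quartic N'_def F'_def by (simp add: eval_nat_numeral algebra_simps)
    then show ?thesis using der by simp
  qed
  show ?thesis
  proof (cases "F = 0")
    case True
    have "F'\<^sup>2 = N + 4 * (2 * r + a) * F"
      unfolding N_def F_def F'_def by (simp add: eval_nat_numeral algebra_simps)
    then have "F' = 0" using True q by simp
    with True show ?thesis
      by (simp add: poly_cubic poly_pderiv_cubic F_def F'_def)
  next
    case False
    \<comment> \<open>The left-hand side is \<open>(4 F)\<^sup>3\<close> times the value of the cubic at \<open>N / (4 F)\<close>.\<close>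
    have "N ^ 3 + 4 * a * N\<^sup>2 * F + 16 * b * N * F\<^sup>2 + 64 * c * F ^ 3 = (N' * F - N * F')\<^sup>2"
      unfolding N_def N'_def F_def F'_def by (simp add: eval_nat_numeral algebra_simps)
    also have "N' * F - N * F' = 0"
      unfolding q q' by simp
    finally have "(4 * x2 * F) ^ 3 + 4 * a * (4 * x2 * F)\<^sup>2 * F + 16 * b * (4 * x2 * F) * F\<^sup>2
        + 64 * c * F ^ 3 = 0"
      unfolding q by simp
    moreover have "(4 * x2 * F) ^ 3 + 4 * a * (4 * x2 * F)\<^sup>2 * F + 16 * b * (4 * x2 * F) * F\<^sup>2
        + 64 * c * F ^ 3 = 2 ^ 6 * F ^ 3 * (x2 ^ 3 + a * x2\<^sup>2 + b * x2 + c)"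
      by (simp add: eval_nat_numeral algebra_simps)
    ultimately have "2 ^ 6 * F ^ 3 * (x2 ^ 3 + a * x2\<^sup>2 + b * x2 + c) = 0"
      by simp
    then have "x2 ^ 3 + a * x2\<^sup>2 + b * x2 + c = 0"
      using False power_not_zero[OF two, of 6] by (metis mult_eq_0_iff power_not_zero)
    then show ?thesis
      using curve by (simp add: poly_cubic)
  qed
qed

section \<open>Explicit factorisations\<close>

lemma cubic_eq_double_root_iff:
  "cubic a b c = [:-s, 1:]^2 * [:-t, 1:] \<longleftrightarrow> a = - (2 * s + t) \<and> b = s\<^sup>2 + 2 * s * t \<and> c = - (s\<^sup>2 * t)"
  by (auto simp: cubic_def power2_eq_square algebra_simps)

lemma cubic_double_root:
  assumes "poly (cubic a b c) s = 0" "poly (pderiv (cubic a b c)) s = 0"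
  shows "cubic a b c = [:-s, 1:]^2 * [:- (- a - 2 * s), 1:]"
proof -
  have F: "s ^ 3 + a * s\<^sup>2 + b * s + c = 0" and F': "3 * s\<^sup>2 + 2 * a * s + b = 0"
    using assms by (simp_all add: poly_cubic poly_pderiv_cubic)
  have "b - (s\<^sup>2 + 2 * s * (- a - 2 * s)) = 3 * s\<^sup>2 + 2 * a * s + b"
    by (simp add: eval_nat_numeral algebra_simps)
  moreover have "c - (- (s\<^sup>2 * (- a - 2 * s))) =
      (s ^ 3 + a * s\<^sup>2 + b * s + c) - s * (3 * s\<^sup>2 + 2 * a * s + b)"
    by (simp add: eval_nat_numeral algebra_simps)
  ultimately show ?thesis
    unfolding cubic_eq_double_root_iff F F' by (simp add: eq_neg_iff_add_eq_0)
qed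

text \<open>
  Since \<open>q = F'\<^sup>2 - 4 (2 x + a + x2) F\<close>, a double root \<open>s\<close> of \<open>F\<close> is a double root of \<open>q\<close> for every
  \<open>x2\<close>. The square root \<open>w\<close> splits the
  remaining quadratic factor. For \<open>t = s\<close> one may take \<open>w = x2 - s\<close>, and then \<open>s\<close> is a third time
  a root.
\<close>

lemma division_quartic_of_double_root:
  fixes a b c s t w x2 :: "'a::field"
  assumes "cubic a b c = [:-s, 1:]^2 * [:-t, 1:]" and "w\<^sup>2 = (x2 - s) * (x2 - t)"
  shows "division_quartic a b c x2 =
    [:-s, 1:]^2 * [:- (2 * x2 - s + 2 * w), 1:] * [:- (2 * x2 - s - 2 * w), 1:]"
proof -
  have "[:- (2 * x2 - s + 2 * w), 1:] * [:- (2 * x2 - s - 2 * w), 1:] =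
      [:s\<^sup>2 - 4 * s * t + 4 * t * x2, 2 * s - 4 * x2, 1:]"
  proof -
    have "[:- (2 * x2 - s + 2 * w), 1:] * [:- (2 * x2 - s - 2 * w), 1:] =
        [:(2 * x2 - s)\<^sup>2 - 4 * w\<^sup>2, 2 * s - 4 * x2, 1:]"
      by (simp add: power2_eq_square algebra_simps)
    also have "(2 * x2 - s)\<^sup>2 - 4 * w\<^sup>2 = s\<^sup>2 - 4 * s * t + 4 * t * x2"
      unfolding assms(2) by (simp add: eval_nat_numeral algebra_simps)
    finally show ?thesis .
  qed
  then show ?thesis
    using assms(1) unfolding cubic_eq_double_root_iff mult.assoc
    by (simp only:) (simp add: division_quartic_def power2_eq_square algebra_simps)
qed

text \<open>
  On a smooth curve with \<open>F = (x - e) (x - e') (x - e'')\<close>, translation by the 2-torsion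
  point \<open>(e, 0)\<close> sends \<open>x - e\<close> to \<open>(e - e') (e - e'') / (x - e) = F'(e) / (x - e)\<close>. It takes a half
  \<open>Q\<close> of \<open>(e, 0)\<close> to \<open>3 Q = - Q\<close>, which has the same \<open>x\<close>-coordinate. Hence the roots \<open>e \<plusminus> w\<close> with
  \<open>w\<^sup>2 = F'(e)\<close>, each taken twice because \<open>Q\<close> and \<open>- Q\<close> are both halves. At a singular
  point \<open>w = 0\<close>, and the four roots coincide.
\<close>

lemma division_quartic_of_root:
  fixes a b c e w :: "'a::field"
  assumes "poly (cubic a b c) e = 0" and "w\<^sup>2 = poly (pderiv (cubic a b c)) e"
  shows "division_quartic a b c e = [:- (e + w), 1:]^2 * [:- (e - w), 1:]^2"
proof -
  have "e ^ 3 + a * e\<^sup>2 + b * e + c = 0" and F': "w\<^sup>2 = 3 * e\<^sup>2 + 2 * a * e + b"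
    using assms by (simp_all add: poly_cubic poly_pderiv_cubic)
  then have F: "c = - (e ^ 3 + a * e\<^sup>2 + b * e)"
    by (simp only: eq_neg_iff_add_eq_0 add.commute[of c])
  have "[:- (e + w), 1:] * [:- (e - w), 1:] = [:e\<^sup>2 - w\<^sup>2, - 2 * e, 1:]"
    by (simp add: power2_eq_square algebra_simps)
  then have "[:- (e + w), 1:]^2 * [:- (e - w), 1:]^2 = [:e\<^sup>2 - w\<^sup>2, - 2 * e, 1:]^2"
    by (simp only: power_mult_distrib[symmetric])
  also have "\<dots> = division_quartic a b c e"
    unfolding F' F division_quartic_def
    by (simp add: eval_nat_numeral algebra_simps)
  finally show ?thesis ..
qed

section \<open>Root patterns\<close>

text \<open>
  The roots are forgotten so that each pattern becomes a constant, and two patterns are incompatible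
  as soon as their constants differ.
\<close>

definition root_multiplicities :: "'a::field poly \<Rightarrow> nat multiset" where
  "root_multiplicities p = image_mset (count (proots p)) (mset_set (set_mset (proots p)))"

lemma proots_linear_power [simp]: "proots ([:-s, 1:]^n) = replicate_mset n s"
  for s :: "'a::field"
  by (simp add: proots_power)

lemma root_multiplicities_22:
  "s \<noteq> t \<Longrightarrow> root_multiplicities ([:-s, 1:]^2 * [:-t, 1:]^2) = {#2, 2#}"
  by (simp add: root_multiplicities_def proots_mult)

lemma root_multiplicities_211:
  "s \<noteq> t \<Longrightarrow> s \<noteq> u \<Longrightarrow> t \<noteq> u \<Longrightarrow>
    root_multiplicities ([:-s, 1:]^2 * [:-t, 1:] * [:-u, 1:]) = {#2, 1, 1#}"
  by (simp add: root_multiplicities_def proots_mult del: mult_pCons_left mult_pCons_right)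

lemma root_multiplicities_31:
  "s \<noteq> t \<Longrightarrow> root_multiplicities ([:-s, 1:]^3 * [:-t, 1:]) = {#3, 1#}"
  by (simp add: root_multiplicities_def proots_mult del: mult_pCons_left mult_pCons_right)

lemma root_multiplicities_4: "root_multiplicities ([:-s, 1:]^4) = {#4#}"
  by (simp add: root_multiplicities_def)

section \<open>Geometry of the cubic\<close>

lemma two_torsion_Affine_iff:
  fixes x y :: "'k::field"
  assumes "(2::'k) \<noteq> 0"
  shows "two_torsion a b c (Affine x y) \<longleftrightarrow> smooth_point a b c (Affine x y) \<and> y = 0"
proof -
  have "y = - y \<longleftrightarrow> 2 * y = 0"
    by (simp add: eq_neg_iff_add_eq_0)
  then show ?thesis
    using assms by (auto simp: two_torsion_def Let_def)
qed

lemma not_smooth_curve_imp_nodal_or_cuspidal: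
  fixes a b c :: "'k::field"
  assumes "(2::'k) \<noteq> 0" and "\<not> smooth_curve a b c"
  shows "nodal a b c \<or> cuspidal a b c"
proof -
  let ?F = "cubic (to_ac a) (to_ac b) (to_ac c)"
  obtain P where "singular_point (to_ac a) (to_ac b) (to_ac c) P"
    using assms(2) unfolding smooth_curve_def by blast
  then obtain s y where sing: "singular_point (to_ac a) (to_ac b) (to_ac c) (Affine s y)"
    by (cases P) auto
  have "(2 :: 'k alg_closure) \<noteq> 0"
    using assms(1) by (metis to_ac_eq_0_iff to_ac_numeral)
  with sing have "poly (pderiv ?F) s = 0" and y: "y = 0"
    by simp_all
  moreover have "poly ?F s = 0"
    using sing unfolding y by simp
  ultimately have F: "?F = [:-s, 1:]^2 * [:- (- to_ac a - 2 * s), 1:]"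
    by (intro cubic_double_root) simp_all
  show ?thesis
  proof (cases "- to_ac a - 2 * s = s")
    case True
    with F show ?thesis
      unfolding cuspidal_def map_poly_to_ac_cubic by (metis power3_eq_cube power2_eq_square)
  next
    case False
    with F show ?thesis
      unfolding nodal_def map_poly_to_ac_cubic by metis
  qed
qed

text \<open>
  The coefficients of \<open>(x - s)\<^sup>3\<close> give \<open>3 s = - a\<close> and \<open>s\<^sup>3 = - c\<close>. Where 3 is invertible the
  first puts \<open>s\<close> into \<open>K\<close>. In characteristic 3 the cube root of \<open>- c\<close> is unique, so one in \<open>K\<close> is
  \<open>s\<close>; without such a root \<open>s\<close> is purely inseparable over \<open>K\<close>.
\<close>

lemma cusp_in_range_to_ac:
  fixes s :: "'k::field alg_closure"
  assumes char: "CHAR('k) = 3 \<longrightarrow> (\<forall>z :: 'k. \<exists>w. w^3 = z)"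
    and F: "cubic (to_ac a) (to_ac b) (to_ac c) = [:-s, 1:]^3"
  shows "s \<in> range to_ac"
proof -
  have "cubic (to_ac a) (to_ac b) (to_ac c) = [:-s, 1:]^2 * [:-s, 1:]"
    unfolding F by (simp only: power3_eq_cube power2_eq_square)
  then have a: "to_ac a = - (2 * s + s)" and c: "to_ac c = - (s\<^sup>2 * s)"
    unfolding cubic_eq_double_root_iff by blast+
  show ?thesis
  proof (cases "CHAR('k) = 3")
    case True
    with char obtain w where w: "w ^ 3 = - c" by blast
    have three: "(3 :: 'k alg_closure) = 0"
      using True of_nat_CHAR[where ?'a = "'k alg_closure"] by simp
    have "(to_ac w - s) ^ 3 = to_ac w ^ 3 - s ^ 3 - 3 * (to_ac w * s * (to_ac w - s))"
      by (simp add: eval_nat_numeral algebra_simps)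
    also have "to_ac w ^ 3 = s ^ 3"
      using c w by (metis minus_minus power2_eq_square power3_eq_cube to_ac_minus to_ac_power)
    finally have "s = to_ac w"
      using three by simp
    then show ?thesis by simp
  next
    case False
    have "CHAR('k) \<noteq> 1" "\<not> CHAR('k) dvd 3"
    proof -
      show "CHAR('k) \<noteq> 1" by simp
      moreover have "prime (3::nat)" by simp
      ultimately show "\<not> CHAR('k) dvd 3"
        using False prime_nat_iff by blast
    qed
    then have three: "(3::'k) \<noteq> 0"
      using of_nat_eq_0_iff_char_dvd[of 3, where ?'a = 'k] by simp
    then have "(3 :: 'k alg_closure) \<noteq> 0"
      by (metis to_ac_eq_0_iff to_ac_numeral)
    moreover have "3 * s = to_ac (- a)"
      using a by simp
    ultimately have "s = to_ac (- a / 3)"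
      by (simp add: field_simps)
    then show ?thesis by blast
  qed
qed

section \<open>The classification\<close>

theorem theorem2:
  fixes a b c x2 y2 :: "'k::field"
  assumes char: "CHAR('k) \<noteq> 2"
    and P2: "on_curve a b c (Affine x2 y2)"
  shows "let P2 = Affine x2 y2;
             q = division_quartic a b c x2;
             qbar = map_poly to_ac q
         in
      (poly_disc q \<noteq> 0 \<longleftrightarrow> smooth_curve a b c \<and> \<not> two_torsion a b c P2)
    \<and> ((\<exists>s t :: 'k alg_closure. s \<noteq> t \<and> qbar = [:-s, 1:]^2 * [:-t, 1:]^2)
         \<longleftrightarrow> two_torsion a b c P2)
    \<and> ((\<exists>s t u :: 'k alg_closure. s \<noteq> t \<and> s \<noteq> u \<and> t \<noteq> u \<and>
            qbar = [:-s, 1:]^2 * [:-t, 1:] * [:-u, 1:])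
         \<longleftrightarrow> nodal a b c \<and> smooth_point a b c P2 \<and> \<not> two_torsion a b c P2)
    \<and> ((\<exists>s t :: 'k alg_closure. s \<noteq> t \<and> qbar = [:-s, 1:]^3 * [:-t, 1:])
         \<longleftrightarrow> cuspidal a b c \<and> smooth_point a b c P2)
    \<and> ((CHAR('k) = 3 \<longrightarrow> (\<forall>z :: 'k. \<exists>w. w^3 = z)) \<longrightarrow>
         ((\<exists>s t :: 'k. s \<noteq> t \<and> q = [:-s, 1:]^3 * [:-t, 1:])
            \<longleftrightarrow> cuspidal a b c \<and> smooth_point a b c P2))
    \<and> ((\<exists>s :: 'k alg_closure. qbar = [:-s, 1:]^4) \<longleftrightarrow> singular_point a b c P2)"
proof -
  define P where "P = Affine x2 y2"
  define q where "q = division_quartic a b c x2"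
  define qbar where "qbar = map_poly to_ac q"
  let ?a = "to_ac a" and ?b = "to_ac b" and ?c = "to_ac c" and ?x = "to_ac x2" and ?y = "to_ac y2"
  let ?F = "cubic ?a ?b ?c"
  let ?simple = "poly_disc q \<noteq> 0"
    and ?two_two = "\<exists>s t. s \<noteq> t \<and> qbar = [:-s, 1:]^2 * [:-t, 1:]^2"
    and ?two_one_one = "\<exists>s t u. s \<noteq> t \<and> s \<noteq> u \<and> t \<noteq> u \<and> qbar = [:-s, 1:]^2 * [:-t, 1:] * [:-u, 1:]"
    and ?three_one = "\<exists>s t. s \<noteq> t \<and> qbar = [:-s, 1:]^3 * [:-t, 1:]"
    and ?four = "\<exists>s. qbar = [:-s, 1:]^4"
    and ?three_one_K = "\<exists>s t. s \<noteq> t \<and> q = [:-s, 1:]^3 * [:-t, 1:]"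

  have "\<not> CHAR('k) dvd 2"
    using char two_is_prime_nat by (metis CHAR_not_1' One_nat_def prime_nat_iff)
  then have two: "(2::'k) \<noteq> 0"
    using of_nat_eq_0_iff_char_dvd[of 2, where ?'a = 'k] by simp
  then have two_ac: "(2 :: 'k alg_closure) \<noteq> 0"
    by (metis to_ac_eq_0_iff to_ac_numeral)
  have qbar: "qbar = division_quartic ?a ?b ?c ?x"
    unfolding qbar_def q_def by (rule map_poly_to_ac_division_quartic)
  have curve: "y2\<^sup>2 = poly (cubic a b c) x2"
    using P2 by simp
  have lift_F: "poly ?F ?x = to_ac (poly (cubic a b c) x2)"
    and lift_F': "poly (pderiv ?F) ?x = to_ac (poly (pderiv (cubic a b c)) x2)"
    by (simp_all add: poly_cubic poly_pderiv_cubic)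
  have curve_ac: "?y\<^sup>2 = poly ?F ?x"
    unfolding lift_F curve[symmetric] by simp
  have singular: "singular_point a b c P \<longleftrightarrow> y2 = 0 \<and> poly (pderiv ?F) ?x = 0"
    using P2 two unfolding lift_F' P_def by simp
  have smooth: "smooth_point a b c P \<longleftrightarrow> \<not> singular_point a b c P"
    using P2 unfolding smooth_point_def P_def by simp
  have torsion: "two_torsion a b c P \<longleftrightarrow> smooth_point a b c P \<and> y2 = 0"
    unfolding P_def by (rule two_torsion_Affine_iff[OF two])

  \<comment> \<open>2-torsion points and singular points share the factorisation for \<open>y\<^sub>2 = 0\<close>; they differ in
     whether \<open>w\<close> vanishes.\<close>
  have from_root: "\<exists>w. w\<^sup>2 = poly (pderiv ?F) ?x \<and> qbar = [:- (?x + w), 1:]^2 * [:- (?x - w), 1:]^2"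
    if "y2 = 0"
  proof -
    obtain w where w: "w\<^sup>2 = poly (pderiv ?F) ?x"
      using nth_root_exists[of 2] by auto
    have "poly ?F ?x = 0"
      using that curve_ac by simp
    from division_quartic_of_root[OF this w] w show ?thesis
      unfolding qbar by blast
  qed

  have singular_imp: ?four if "singular_point a b c P"
  proof -
    from that have "y2 = 0" "poly (pderiv ?F) ?x = 0" unfolding singular by auto
    with from_root have "qbar = [:-?x, 1:]^2 * [:-?x, 1:]^2" by auto
    then have "qbar = [:-?x, 1:]^4" by (simp only: power_add[symmetric]) simp
    then show ?thesis ..
  qed

  have torsion_imp: ?two_two if "two_torsion a b c P"
  proof -
    from that have "y2 = 0" "poly (pderiv ?F) ?x \<noteq> 0" unfolding torsion smooth singular by auto
    with from_root obtain w where "w\<^sup>2 \<noteq> 0" and w: "qbar = [:- (?x + w), 1:]^2 * [:- (?x - w), 1:]^2"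
      by metis
    have "?x + w \<noteq> ?x - w"
    proof
      assume "?x + w = ?x - w"
      then have "2 * w = 0" by (simp add: algebra_simps flip: mult_2)
      with \<open>w\<^sup>2 \<noteq> 0\<close> two_ac show False by simp
    qed
    with w show ?thesis by blast
  qed

  have x_not_singular: "?x \<noteq> s" if "?F = [:-s, 1:]^2 * [:-t, 1:]" "smooth_point a b c P" for s t
  proof
    assume "?x = s"
    then have "poly ?F ?x = 0" "poly (pderiv ?F) ?x = 0"
      using multiple_root_of_square_factor[OF that(1)] by simp_all
    with curve_ac that(2) show False
      unfolding smooth singular by simp
  qed

  have nodal_imp: ?two_one_one
    if "nodal a b c" "smooth_point a b c P" "\<not> two_torsion a b c P"
  proof -
    from that(1) obtain s t where st: "s \<noteq> t" and F: "?F = [:-s, 1:]^2 * [:-t, 1:]"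
      unfolding nodal_def map_poly_to_ac_cubic by blast
    obtain w where w: "w\<^sup>2 = (?x - s) * (?x - t)"
      using nth_root_exists[of 2] by auto
    have q: "qbar = [:-s, 1:]^2 * [:- (2 * ?x - s + 2 * w), 1:] * [:- (2 * ?x - s - 2 * w), 1:]"
      unfolding qbar by (rule division_quartic_of_double_root[OF F w])
    have xs: "?x \<noteq> s" using x_not_singular[OF F that(2)] .
    moreover have "?x \<noteq> t"
    proof
      assume "?x = t"
      then have "poly ?F ?x = 0" unfolding F by simp
      then have "y2 = 0" using curve_ac by simp
      with that show False unfolding torsion by simp
    qed
    ultimately have "w \<noteq> 0" using w by auto
    \<comment> \<open>A root \<open>2 x\<^sub>2 - s \<plusminus> 2 w\<close> equal to \<open>s\<close> would mean \<open>w = \<mp> (x\<^sub>2 - s)\<close>, hence \<open>s = t\<close>.\<close>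
    have "(?x - s)\<^sup>2 \<noteq> w\<^sup>2"
      using xs st unfolding w by (auto simp: power2_eq_square)
    then have ne: "?x - s + w \<noteq> 0" "?x - s - w \<noteq> 0"
      by (auto simp: eq_neg_iff_add_eq_0 power2_eq_iff)
    have "(2 * ?x - s + 2 * w) - s = 2 * (?x - s + w)" "(2 * ?x - s - 2 * w) - s = 2 * (?x - s - w)"
      "(2 * ?x - s + 2 * w) - (2 * ?x - s - 2 * w) = 2 * (2 * w)"
      by (simp_all add: algebra_simps)
    then have "s \<noteq> 2 * ?x - s + 2 * w" "s \<noteq> 2 * ?x - s - 2 * w"
        "2 * ?x - s + 2 * w \<noteq> 2 * ?x - s - 2 * w"
      using ne \<open>w \<noteq> 0\<close> two_ac by (metis diff_self mult_eq_0_iff)+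
    with q show ?thesis by blast
  qed

  \<comment> \<open>The witnesses are kept in the statement because the version over \<open>K\<close> reuses them.\<close>
  have cuspidal_imp: "\<exists>s. ?F = [:-s, 1:]^3 \<and> s \<noteq> 4 * ?x - 3 * s \<and> qbar = [:-s, 1:]^3 * [:- (4 * ?x - 3 * s), 1:]"
    if "cuspidal a b c" "smooth_point a b c P"
  proof -
    from that(1) obtain s where s: "?F = [:-s, 1:]^3"
      unfolding cuspidal_def map_poly_to_ac_cubic by blast
    then have F: "?F = [:-s, 1:]^2 * [:-s, 1:]"
      by (simp only: power3_eq_cube power2_eq_square)
    have "(?x - s)\<^sup>2 = (?x - s) * (?x - s)" by (rule power2_eq_square)
    from division_quartic_of_double_root[OF F this]
    have "qbar = [:-s, 1:]^2 * [:- (4 * ?x - 3 * s), 1:] * [:-s, 1:]"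
      unfolding qbar by (simp add: algebra_simps)
    also have "\<dots> = [:-s, 1:]^3 * [:- (4 * ?x - 3 * s), 1:]"
      by (simp only: power3_eq_cube power2_eq_square mult_ac)
    finally have q: "qbar = [:-s, 1:]^3 * [:- (4 * ?x - 3 * s), 1:]" .
    have "(4 * ?x - 3 * s) - s = 2 * (2 * (?x - s))"
      by (simp add: algebra_simps)
    then have "s \<noteq> 4 * ?x - 3 * s"
      using x_not_singular[OF F that(2)] two_ac by (metis diff_self eq_iff_diff_eq_0 mult_eq_0_iff)
    with s q show ?thesis by blast
  qed

  have disc: "poly_disc q = 0 \<longleftrightarrow> (\<exists>r. poly qbar r = 0 \<and> poly (pderiv qbar) r = 0)"
    unfolding qbar_def by (rule poly_disc_eq_0_iff_multiple_root) (simp add: q_def division_quartic_def)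
  have smooth_imp: ?simple if "smooth_curve a b c" "\<not> two_torsion a b c P"
  proof
    assume "poly_disc q = 0"
    then obtain r where r: "poly qbar r = 0" "poly (pderiv qbar) r = 0"
      using disc by blast
    have no_sing: "\<not> singular_point ?a ?b ?c (Affine r' 0)" for r'
      using that(1) unfolding smooth_curve_def by blast
    have "\<not> (poly ?F r' = 0 \<and> poly (pderiv ?F) r' = 0)" for r'
      using no_sing[of r'] by auto
    moreover from this have "y2 \<noteq> 0"
      using that(2) curve_ac unfolding torsion smooth singular by auto
    ultimately show False
      using division_quartic_multiple_root[OF two_ac curve_ac r[unfolded qbar]] by auto
  qed
  have not_simple: "\<not> ?simple" if patterns: "?two_two \<or> ?two_one_one \<or> ?three_one \<or> ?four"
  proof -
    have high: "[:-s, 1:]^2 dvd [:-s, 1:]^3" "[:-s, 1:]^2 dvd [:-s, 1:]^4" for s :: "'k alg_closure"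
      by (simp_all only: le_imp_power_dvd numeral_le_iff semiring_norm)
    have "\<exists>s. [:-s, 1:]^2 dvd qbar"
      using patterns
    proof (elim disjE exE conjE)
      fix s t assume "qbar = [:-s, 1:]^2 * [:-t, 1:]^2"
      then show ?thesis by (intro exI[of _ s]) (simp only: dvd_triv_left)
    next
      fix s t u assume "qbar = [:-s, 1:]^2 * [:-t, 1:] * [:-u, 1:]"
      then show ?thesis by (intro exI[of _ s]) (simp only: mult.assoc dvd_triv_left)
    next
      fix s t assume "qbar = [:-s, 1:]^3 * [:-t, 1:]"
      then show ?thesis by (intro exI[of _ s]) (simp only: high dvd_mult2)
    next
      fix s assume "qbar = [:-s, 1:]^4"
      then show ?thesis by (intro exI[of _ s]) (simp only: high)
    qed
    then show ?thesis
      unfolding disc dvd_def using multiple_root_of_square_factor by blast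
  qed
  have mult_22: "root_multiplicities qbar = {#2, 2#}" if ?two_two
    using that root_multiplicities_22 by blast
  have mult_211: "root_multiplicities qbar = {#2, 1, 1#}" if ?two_one_one
    using that root_multiplicities_211 by blast
  have mult_31: "root_multiplicities qbar = {#3, 1#}" if ?three_one
    using that root_multiplicities_31 by blast
  have mult_4: "root_multiplicities qbar = {#4#}" if ?four
    using that root_multiplicities_4 by blast
  have distinct: "{#2, 2#} \<noteq> {#2, 1, 1::nat#}" "{#2, 2#} \<noteq> {#3, 1::nat#}" "{#2, 2#} \<noteq> {#4::nat#}"
    "{#2, 1, 1#} \<noteq> {#3, 1::nat#}" "{#2, 1, 1#} \<noteq> {#4::nat#}" "{#3, 1#} \<noteq> {#4::nat#}"
    by (auto simp: add_mset_eq_single add_eq_conv_ex)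

  have exhaust: "smooth_curve a b c \<or> nodal a b c \<or> cuspidal a b c"
    using not_smooth_curve_imp_nodal_or_cuspidal[OF two] by blast
  have cuspidal_three_one: ?three_one if "cuspidal a b c" "smooth_point a b c P"
    using cuspidal_imp[OF that] by blast

  have three_one_K: "?three_one_K \<longleftrightarrow> cuspidal a b c \<and> smooth_point a b c P"
    if perfect: "CHAR('k) = 3 \<longrightarrow> (\<forall>z :: 'k. \<exists>w. w^3 = z)"
    and three_one: "?three_one \<longleftrightarrow> cuspidal a b c \<and> smooth_point a b c P"
  proof
    have lift: "map_poly to_ac ([:-s, 1:]^3 * [:-t, 1:]) = [:-to_ac s, 1:]^3 * [:-to_ac t, 1:]" for s t :: 'k
      by (simp add: to_ac_poly.hom_mult to_ac_poly.hom_power map_poly_pCons del: mult_pCons_left mult_pCons_right)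
    {
      assume ?three_one_K
      then show "cuspidal a b c \<and> smooth_point a b c P"
        unfolding three_one[symmetric] qbar_def using lift to_ac_eq_iff by metis
    next
      assume "cuspidal a b c \<and> smooth_point a b c P"
      then obtain s where s: "?F = [:-s, 1:]^3" "s \<noteq> 4 * ?x - 3 * s"
          "qbar = [:-s, 1:]^3 * [:- (4 * ?x - 3 * s), 1:]"
        using cuspidal_imp by blast
      obtain r where r: "s = to_ac r"
        using cusp_in_range_to_ac[OF perfect s(1)] by blast
      have "map_poly to_ac q = map_poly to_ac ([:-r, 1:]^3 * [:-(4 * x2 - 3 * r), 1:])"
        unfolding lift using s(3) r unfolding qbar_def by simp
      then have "q = [:-r, 1:]^3 * [:-(4 * x2 - 3 * r), 1:]"
        by simp
      moreover have "r \<noteq> 4 * x2 - 3 * r"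
        using s(2) unfolding r by (metis to_ac_diff to_ac_mult to_ac_numeral)
      ultimately show ?three_one_K by blast
    }
  qed

  have exclusive: "\<not> (?two_two \<and> ?two_one_one)" "\<not> (?two_two \<and> ?three_one)" "\<not> (?two_two \<and> ?four)"
    "\<not> (?two_one_one \<and> ?three_one)" "\<not> (?two_one_one \<and> ?four)" "\<not> (?three_one \<and> ?four)"
    using mult_22 mult_211 mult_31 mult_4 distinct by (metis (lifting))+
  \<comment> \<open>Every pair lies in one of five classes, each class forces its pattern, and the patterns are
     pairwise exclusive; the converses are then propositional.\<close>
  have five_cases: "smooth_curve a b c \<and> \<not> two_torsion a b c P \<or> two_torsion a b c P
    \<or> nodal a b c \<and> smooth_point a b c P \<and> \<not> two_torsion a b c P
    \<or> cuspidal a b c \<and> smooth_point a b c P \<or> singular_point a b c P"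
    using exhaust smooth by blast
  have equivalences: "?simple \<longleftrightarrow> smooth_curve a b c \<and> \<not> two_torsion a b c P"
    "?two_two \<longleftrightarrow> two_torsion a b c P"
    "?two_one_one \<longleftrightarrow> nodal a b c \<and> smooth_point a b c P \<and> \<not> two_torsion a b c P"
    "?three_one \<longleftrightarrow> cuspidal a b c \<and> smooth_point a b c P"
    "?four \<longleftrightarrow> singular_point a b c P"
    using five_cases smooth_imp torsion_imp nodal_imp cuspidal_three_one singular_imp
      not_simple exclusive by argo+
  show ?thesis
    unfolding Let_def P_def[symmetric] q_def[symmetric] qbar_def[symmetric]
    using equivalences three_one_K by argo
qed

end
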